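(* Fix $0<\tau<1$ and $\lambda>0$. Let $y_i=\theta^*_i+\epsilon_i$, $1\le i\le n$, where $\theta^*\in\mathbb{R}^n$ is piecewise constant with $K$ pieces (see context) and $\epsilon_1,\dots,\epsilon_n$ are i.i.d. with CDF $F$ such that $F(0)=\tau$ and $F$ is continuous and strictly increasing at $0$ (see context). Let $\rho(x)=\tau|x|$ for $x\ge0$ and $\rho(x)=(1-\tau)|x|$ for $x<0$, and let $$\hat\theta=\arg\min_{\theta\in\mathbb{R}^n}\ \sum_{i=1}^n\rho(y_i-\theta_i)+\lambda\sum_{i=1}^{n-1}|\theta_i-\theta_{i+1}|.$$ Fix any $i\in\{1,\dots,n\}$. Then for every $\delta\in(0,\tfrac{\log2}{e})$: 1. $\Pr\big(F^-(\hat\theta_i-\theta^*_i)-F^-(0)\ge B^{\mathrm{quantile}}_{i,\delta}\big)\le\big(1+\tfrac{24}{(\log2)^2}\big)\delta^2$; 2. $\Pr\big(F(0)-F(\hat\theta_i-\theta^*_i)\ge B^{\mathrm{quantile}}_{i,\delta}\big)\le\big(1+\tfrac{24}{(\log2)^2}\big)\delta^2$, where $$B^{\mathrm{quantile}}_{i,\delta}=2\left(\sqrt{\frac{\log\log(2\max(3,d_i))}{\max(3,d_i)}}+\sqrt{\frac{\log\frac1\delta}{d_i}}\right)+\frac{\log\log(2m_{k(i)})+\log\frac1\delta}{\lambda}+\frac{\sqrt{m_{k(i)}\log\frac1\delta}+2\lambda}{m_{k(i)}}.$$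
   Context: $F^-(t)=\lim_{s\uparrow t}F(s)$ is the left limit of the CDF $F$. "$F$ is continuous and strictly increasing at $0$" means $F$ is continuous at $0$ and $F(s)<F(0)<F(t)$ for all $s<0<t$ (so $0$ is the unique $\tau$-quantile). $\theta^*$ is piecewise constant with $K$ pieces: there are integers $1=n_1<n_2<\cdots<n_K<n$, with the convention $n_{K+1}=n+1$, such that $\theta^*_{n_k}=\theta^*_{n_k+1}=\cdots=\theta^*_{n_{k+1}-1}$ for each $1\le k\le K$. The length of the $k$-th piece is $m_k=n_{k+1}-n_k$. For $i\in\{1,\dots,n\}$, $k(i)$ is the index of the piece containing $i$, i.e. $n_{k(i)}\le i\le n_{k(i)+1}-1$, and $d_i=\min(i+1-n_{k(i)},\,n_{k(i)+1}-i)$. $\arg\min$ denotes a minimizer; $\log$ is the natural logarithm. *)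

theory Defs
  imports "HOL-Probability.Probability"
begin

(* Vectors in R^n are functions nat \<Rightarrow> real of which only the coordinates 1..n matter. *)

definition left_limit :: "(real \<Rightarrow> real) \<Rightarrow> real \<Rightarrow> real" where
  "left_limit F t = Lim (at_left t) F"

definition quantile_loss :: "real \<Rightarrow> real \<Rightarrow> real" where
  "quantile_loss \<tau> x = (if x \<ge> 0 then \<tau> * \<bar>x\<bar> else (1 - \<tau>) * \<bar>x\<bar>)"

definition fused_objective ::
  "real \<Rightarrow> real \<Rightarrow> nat \<Rightarrow> (nat \<Rightarrow> real) \<Rightarrow> (nat \<Rightarrow> real) \<Rightarrow> real" where
  "fused_objective \<tau> lam n y \<theta> =
     (\<Sum>i=1..n. quantile_loss \<tau> (y i - \<theta> i)) + lam * (\<Sum>i=1..n - 1. \<bar>\<theta> i - \<theta> (i + 1)\<bar>)"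

(* The argument p lists the left endpoints p 1 < ... < p K of the pieces, followed by
   p (K + 1) = n + 1. Values on adjacent pieces are not required to differ. *)
definition piecewise_constant ::
  "nat \<Rightarrow> nat \<Rightarrow> (nat \<Rightarrow> nat) \<Rightarrow> (nat \<Rightarrow> real) \<Rightarrow> bool" where
  "piecewise_constant n K p \<theta> \<longleftrightarrow>
     K \<ge> 1 \<and> p 1 = 1 \<and> strict_mono_on {1..K} p \<and> p K < n \<and> p (K + 1) = n + 1 \<and>
     (\<forall>k\<in>{1..K}. \<forall>j\<in>{p k..p (k + 1) - 1}. \<theta> j = \<theta> (p k))"

definition piece_index :: "nat \<Rightarrow> (nat \<Rightarrow> nat) \<Rightarrow> nat \<Rightarrow> nat" where
  "piece_index K p i = (THE k. k \<in> {1..K} \<and> p k \<le> i \<and> i \<le> p (k + 1) - 1)"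

definition piece_length :: "(nat \<Rightarrow> nat) \<Rightarrow> nat \<Rightarrow> nat" where
  "piece_length p k = p (k + 1) - p k"

definition boundary_dist :: "nat \<Rightarrow> (nat \<Rightarrow> nat) \<Rightarrow> nat \<Rightarrow> nat" where
  "boundary_dist K p i =
     (let k = piece_index K p i in min (i + 1 - p k) (p (k + 1) - i))"

definition B_quantile :: "real \<Rightarrow> nat \<Rightarrow> (nat \<Rightarrow> nat) \<Rightarrow> nat \<Rightarrow> real \<Rightarrow> real" where
  "B_quantile lam K p i \<delta> =
     (let d = boundary_dist K p i; m = real (piece_length p (piece_index K p i)) in
        2 * (sqrt (ln (ln (2 * real (max 3 d))) / real (max 3 d)) + sqrt (ln (1 / \<delta>) / real d))
        + (ln (ln (2 * m)) + ln (1 / \<delta>)) / lam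
        + (sqrt (m * ln (1 / \<delta>)) + 2 * lam) / m)"

end

theory Submission
  imports Defs
begin

text \<open>
  Suppose the fit at \<open>i\<close> is far above the truth. Consider the component around \<open>i\<close>, inside the piece of
  \<open>i\<close>, of the set where the fit is at least its value at \<open>i\<close>. Pushing the fit down on this interval cannot
  lower the objective. Since the loss is piecewise linear, this says that at most a fraction \<open>\<tau>\<close> of the
  observations in the interval lie below the fit, up to a penalty term of \<open>- 2 * lam\<close>, \<open>0\<close> or \<open>2 * lam\<close>
  according to how many ends the interval shares with the piece (\<open>few_observations_below_fit\<close>). On the piece
  the truth is constant, so each observation falls below the fit at least when its noise lies in a fixed half-line
  \<open>A\<close> whose probability exceeds \<open>\<tau>\<close> by the error bound (\<open>half_line_threshold\<close>). Hence some
  interval around \<open>i\<close> has far fewer noise variables in \<open>A\<close> than expected.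
  
  Such deviations are rare for every interval simultaneously. Random walks of centred indicators started at the
  two ends of the piece, and at \<open>i\<close> in both directions, stay below a boundary of order
  \<open>sqrt (t * (ln (ln t) + ln (1 / \<delta>)))\<close> for all times (\<open>finite_lil\<close>), and the whole piece obeys Hoeffding's
  bound (\<open>maximal_hoeffding\<close>). Walks from the ends control intervals that share one end with the piece; there the penalty is
  neutral but the interval has length at least the distance to the boundary. Walks from \<open>i\<close> control the intervals
  strictly inside; these may be short, but the penalty works against the deviation, and the arithmetic-geometric
  mean inequality trades it for a multiple of \<open>1 / lam\<close>. For the whole piece the penalty helps the deviation, at a cost
  of \<open>2 * lam\<close> divided by the length of the piece. These cases produce the three summands of the error bound
  (\<open>interval_sums_below_bound\<close>).
  
  Underestimation reduces to overestimation by negating everything (\<open>is_arg_min_reflect\<close>).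
\<close>

section \<open>The boundary of the law of the iterated logarithm\<close>

text \<open>
  The boundary of a finite law of the iterated logarithm: a centred walk with
  increments of range one crosses it at some time with probability \<open>O(\<delta>\<^sup>2)\<close>. The two
  logarithms are kept apart because they are bounded by different terms of the final error bound.
\<close>

definition lil_boundary :: "real \<Rightarrow> nat \<Rightarrow> real" where
  "lil_boundary \<delta> t = 2 * sqrt (real t * (ln (ln (2 * real t)) + ln (1 / \<delta>)))"

text \<open>
  The restriction on \<open>\<delta>\<close> exists for this: it makes the quantity under the root positive already at
  time one, where the iterated logarithm is negative.
\<close>

lemma lil_exponent_gt_1:
  fixes \<delta> t :: real
  assumes "0 < \<delta>" "\<delta> < ln 2 / exp 1" "1 \<le> t"
  shows "1 < ln (ln (2 * t)) + ln (1 / \<delta>)"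
proof -
  have "exp 1 < ln 2 / \<delta>" using assms by (simp add: field_simps)
  also have "\<dots> \<le> ln (2 * t) / \<delta>" using assms by (intro divide_right_mono) auto
  finally have "ln (exp 1) < ln (ln (2 * t) / \<delta>)"
    by (intro ln_less_cancel_iff[THEN iffD2]) (auto intro: less_trans[OF exp_gt_zero])
  thus ?thesis using assms by (simp add: ln_div)
qed

lemma loglog_mono: "1 \<le> s \<Longrightarrow> s \<le> t \<Longrightarrow> ln (ln (2 * s)) \<le> ln (ln (2 * t))" for s t :: real
  by (intro ln_mono) auto

lemma lil_boundary_mono:
  assumes "0 < \<delta>" "\<delta> < ln 2 / exp 1" "1 \<le> s" "s \<le> t"
  shows "lil_boundary \<delta> s \<le> lil_boundary \<delta> t"
  unfolding lil_boundary_def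
  using assms lil_exponent_gt_1[OF assms(1,2), of "real s"] loglog_mono[of "real s" "real t"]
  by (intro mult_left_mono real_sqrt_le_mono mult_mono add_right_mono) auto

text \<open>
  Telescoping against \<open>1 / N - 1 / (N + 1)\<close>; it pays for the union bound over dyadic blocks.
\<close>

lemma sum_inverse_squares_le_2: "(\<Sum>k<N. 1 / (real k + 1)\<^sup>2) \<le> 2"
proof -
  have "(\<Sum>k<N. 1 / (real k + 1)\<^sup>2) \<le> 2 - 1 / real N" if "N \<ge> 1"
    using that
  proof (induction N rule: dec_induct)
    case (step N)
    have "1 / (real N + 1)\<^sup>2 \<le> 1 / (real N * (real N + 1))"
      using step.hyps by (intro divide_left_mono) (auto simp: power2_eq_square)
    also have "\<dots> = 1 / real N - 1 / real (Suc N)" using step.hyps by (simp add: field_simps)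
    finally show ?case using step.IH by simp
  qed auto
  thus ?thesis by (cases "N = 0") (auto intro: order_trans)
qed

section \<open>Maximal inequalities for bounded random walks\<close>

text \<open>
  The increments later are centred indicators, so they all live in one common interval of length one.
\<close>

locale centred_unit_range_noise = prob_space M for M :: "'a measure" +
  fixes X :: "nat \<Rightarrow> 'a \<Rightarrow> real" and I :: "nat set" and \<alpha> :: real
  assumes indep: "indep_vars (\<lambda>_. borel) X I"
    and range: "\<And>j \<omega>. j \<in> I \<Longrightarrow> \<omega> \<in> space M \<Longrightarrow> X j \<omega> \<in> {\<alpha>..\<alpha> + 1}"
    and mean: "\<And>j. j \<in> I \<Longrightarrow> expectation (X j) = 0"
begin

lemma measurable_noise: "j \<in> I \<Longrightarrow> X j \<in> borel_measurable M"
  using indep by (auto simp: indep_vars_def)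

text \<open>
  The walk visits the noise variables in the order given by \<open>\<sigma>\<close>. Walks that start at different
  points of an interval and run in either direction are thus treated without relabelling the noise.
\<close>

definition walk :: "(nat \<Rightarrow> nat) \<Rightarrow> nat \<Rightarrow> 'a \<Rightarrow> real" where
  "walk \<sigma> t \<omega> = (\<Sum>j<t. X (\<sigma> j) \<omega>)"

lemma measurable_walk:
  assumes "\<sigma> ` {..<N} \<subseteq> I" "t \<le> N"
  shows "walk \<sigma> t \<in> borel_measurable M"
  unfolding walk_def using assms by (intro borel_measurable_sum measurable_noise) auto

text \<open>
  Hoeffding's lemma, normalised so that the exponentials are the factors of a nonnegative
  supermartingale.
\<close>

lemma exp_noise:
  assumes "j \<in> I" "l > 0"
  shows "integrable M (\<lambda>\<omega>. exp (l * X j \<omega> - l\<^sup>2 / 8))"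
    and "expectation (\<lambda>\<omega>. exp (l * X j \<omega> - l\<^sup>2 / 8)) \<le> 1"
proof -
  interpret interval_bounded_random_variable M "X j" \<alpha> "\<alpha> + 1"
    by unfold_locales (use assms range measurable_noise in auto)
  have [measurable]: "X j \<in> borel_measurable M" using assms measurable_noise by auto
  have "exp (l * X j \<omega>) \<le> exp (l * (\<alpha> + 1))" if "\<omega> \<in> space M" for \<omega>
    using range[OF assms(1) that] assms(2) by simp
  hence int: "integrable M (\<lambda>\<omega>. exp (l * X j \<omega>))"
    by (intro integrable_const_bound[where B = "exp (l * (\<alpha> + 1))"]) auto
  have "ennreal (expectation (\<lambda>\<omega>. exp (l * X j \<omega>))) \<le> ennreal (exp (l\<^sup>2 / 8))"
    using Hoeffdings_lemma_nn_integral_0[OF assms(2) mean[OF assms(1)]] int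
    by (subst nn_integral_eq_integral[symmetric]) auto
  hence "expectation (\<lambda>\<omega>. exp (l * X j \<omega>)) \<le> exp (l\<^sup>2 / 8)"
    by (simp add: ennreal_le_iff)
  thus "expectation (\<lambda>\<omega>. exp (l * X j \<omega> - l\<^sup>2 / 8)) \<le> 1"
    by (simp add: exp_diff divide_le_eq)
  show "integrable M (\<lambda>\<omega>. exp (l * X j \<omega> - l\<^sup>2 / 8))"
    using int by (simp add: exp_diff)
qed

text \<open>
  This is Ville's inequality for the supermartingale \<open>exp (L t)\<close> with
  \<open>L t = l * walk \<sigma> t - t * l\<^sup>2 / 8\<close>. Let \<open>C t\<close> be the event that \<open>L\<close> has reached \<open>c\<close> by time \<open>t\<close>. The
  potential \<open>E [exp (L t); not C t] + exp c * P (C t)\<close> starts at most at one and never grows: a path that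
  has not crossed multiplies its weight by an independent factor of mean at most one, and a path that
  crosses now has weight at least \<open>exp c\<close>. No stopping time has to be formed.
\<close>

lemma line_crossing_bound:
  assumes inj: "inj_on \<sigma> {..<N}" and ran: "\<sigma> ` {..<N} \<subseteq> I" and l: "l > 0"
  shows "prob {\<omega> \<in> space M. \<exists>t\<le>N. c \<le> l * walk \<sigma> t \<omega> - real t * (l\<^sup>2 / 8)} \<le> exp (- c)"
proof -
  define L where "L t \<omega> = l * walk \<sigma> t \<omega> - real t * (l\<^sup>2 / 8)" for t \<omega>
  define Y where "Y t \<omega> = exp (L t \<omega>) * of_bool (\<forall>s\<le>t. L s \<omega> < c)" for t \<omega>
  define C where "C t = {\<omega> \<in> space M. \<exists>s\<le>t. c \<le> L s \<omega>}" for t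
  have L_meas: "L t \<in> borel_measurable M" if "t \<le> N" for t
    unfolding L_def using measurable_walk[OF ran that] by measurable
  have C_meas: "C t \<in> events" if "t \<le> N" for t
  proof -
    have "C t = (\<Union>s\<in>{..t}. {\<omega> \<in> space M. c \<le> L s \<omega>})" by (auto simp: C_def)
    also have "\<dots> \<in> events"
    proof (intro sets.finite_UN)
      fix s assume "s \<in> {..t}"
      hence [measurable]: "L s \<in> borel_measurable M" using that L_meas by auto
      show "{\<omega> \<in> space M. c \<le> L s \<omega>} \<in> events" by measurable
    qed auto
    finally show ?thesis .
  qed
  have Y_alt: "Y t \<omega> = exp (L t \<omega>) * indicator (space M - C t) \<omega>" if "\<omega> \<in> space M" for t \<omega>
    using that by (auto simp: Y_def C_def indicator_def not_le[of c])
  have Y_meas: "Y t \<in> borel_measurable M" if "t \<le> N" for t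
  proof -
    have [measurable]: "C t \<in> events" "L t \<in> borel_measurable M"
      using that C_meas L_meas by auto
    have "(\<lambda>\<omega>. exp (L t \<omega>) * indicator (space M - C t) \<omega>) \<in> borel_measurable M" by measurable
    thus ?thesis using Y_alt by (subst measurable_cong[OF Y_alt]) auto
  qed
  have Y_int: "integrable M (Y t)" if "t \<le> N" for t
    using Y_meas[OF that]
    by (intro integrable_const_bound[where B = "exp c"]) (auto simp: Y_def less_imp_le)
  have C_ind: "integrable M (indicat_real (C t))" "expectation (indicat_real (C t)) = prob (C t)"
    if "t \<le> N" for t
  proof -
    show "integrable M (indicat_real (C t))"
      using C_meas[OF that] by (intro integrable_const_bound[where B = 1]) auto
    show "expectation (indicat_real (C t)) = prob (C t)"
      using sets.sets_into_space[OF C_meas[OF that]] by (simp add: Int_absorb2)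
  qed
  have claim: "expectation (Y t) + exp c * prob (C t) \<le> 1" if "t \<le> N" for t
    using that
  proof (induction t)
    case 0
    have L0: "L 0 \<omega> = 0" for \<omega> by (simp add: L_def walk_def)
    show ?case
    proof (cases "c \<le> 0")
      case True
      hence "Y 0 = (\<lambda>_. 0)" "C 0 = space M" by (auto simp: Y_def L0 C_def fun_eq_iff)
      thus ?thesis using True by (simp add: prob_space)
    next
      case False
      hence "Y 0 = (\<lambda>_. 1)" "C 0 = {}" by (auto simp: Y_def L0 C_def fun_eq_iff)
      thus ?thesis by (simp add: prob_space)
    qed
  next
    case (Suc t)
    hence t: "t \<le> N" "t < N" by auto
    have \<sigma>t: "\<sigma> t \<in> I" "\<sigma> ` {..<t} \<subseteq> I" "\<sigma> t \<notin> \<sigma> ` {..<t}"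
      using t ran inj_onD[OF inj, of t] by fastforce+
    define Z where "Z \<omega> = exp (l * X (\<sigma> t) \<omega> - l\<^sup>2 / 8)" for \<omega>
    have Z: "integrable M Z" "expectation Z \<le> 1"
      unfolding Z_def using exp_noise[OF \<sigma>t(1) l] by auto
    have LS: "L (Suc t) \<omega> = L t \<omega> + (l * X (\<sigma> t) \<omega> - l\<^sup>2 / 8)" for \<omega>
      by (simp add: L_def walk_def algebra_simps)
    \<comment> \<open>\<open>Y t\<close> is a function \<open>h\<close> of the first \<open>t\<close> noise variables, hence independent of the next one.\<close>
    have ind: "indep_var borel (Y t) borel Z"
    proof -
      define A where "A = \<sigma> ` {..<t}"
      define G where "G s x = l * (\<Sum>j<s. x (\<sigma> j)) - real s * (l\<^sup>2 / 8)" for s and x :: "nat \<Rightarrow> real"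
      have G_meas: "G s \<in> borel_measurable (PiM A (\<lambda>_. borel))" if "s \<le> t" for s
      proof -
        have "(\<lambda>x. x (\<sigma> j) :: real) \<in> borel_measurable (PiM A (\<lambda>_. borel))" if "j < s" for j
          by (rule measurable_component_singleton) (use that \<open>s \<le> t\<close> in \<open>auto simp: A_def\<close>)
        hence "(\<lambda>x. \<Sum>j<s. x (\<sigma> j) :: real) \<in> borel_measurable (PiM A (\<lambda>_. borel))"
          by (intro borel_measurable_sum) auto
        thus ?thesis unfolding G_def by measurable
      qed
      define h where "h x = exp (G t x) * (\<Prod>s\<le>t. of_bool (G s x < c))" for x :: "nat \<Rightarrow> real"
      have h_meas: "h \<in> borel_measurable (PiM A (\<lambda>_. borel))"
      proof -
        have "(\<lambda>x. of_bool (G s x < c) :: real) \<in> borel_measurable (PiM A (\<lambda>_. borel))" if "s \<le> t" for s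
        proof -
          have [measurable]: "G s \<in> borel_measurable (PiM A (\<lambda>_. borel))" using G_meas that .
          show ?thesis by measurable
        qed
        moreover have [measurable]: "G t \<in> borel_measurable (PiM A (\<lambda>_. borel))" using G_meas by auto
        ultimately show ?thesis unfolding h_def by (intro borel_measurable_times borel_measurable_prod) auto
      qed
      have "indep_var borel (h \<circ> (\<lambda>\<omega>. restrict (\<lambda>i. X i \<omega>) A))
              borel ((\<lambda>x. exp (l * x (\<sigma> t) - l\<^sup>2 / 8)) \<circ> (\<lambda>\<omega>. restrict (\<lambda>i. X i \<omega>) {\<sigma> t}))"
        by (rule indep_var_compose[OF indep_var_restrict[OF indep] h_meas])
           (use \<sigma>t in \<open>auto simp: A_def\<close>)
      also have "h \<circ> (\<lambda>\<omega>. restrict (\<lambda>i. X i \<omega>) A) = Y t"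
      proof
        fix \<omega>
        have "G s (restrict (\<lambda>i. X i \<omega>) A) = L s \<omega>" if "s \<le> t" for s
          using that by (auto simp: G_def L_def walk_def A_def intro!: sum.cong)
        thus "(h \<circ> (\<lambda>\<omega>. restrict (\<lambda>i. X i \<omega>) A)) \<omega> = Y t \<omega>"
          by (auto simp: h_def Y_def)
      qed
      also have "(\<lambda>x. exp (l * x (\<sigma> t) - l\<^sup>2 / 8)) \<circ> (\<lambda>\<omega>. restrict (\<lambda>i. X i \<omega>) {\<sigma> t}) = Z"
        by (simp add: Z_def fun_eq_iff)
      finally show ?thesis .
    qed
    have YZ_int: "integrable M (\<lambda>\<omega>. Y t \<omega> * Z \<omega>)"
      using indep_var_integrable[OF ind Y_int[OF t(1)] Z(1)] .
    have "expectation (Y (Suc t)) + exp c * prob (C (Suc t))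
        = expectation (\<lambda>\<omega>. Y (Suc t) \<omega> + exp c * indicator (C (Suc t)) \<omega>)"
      using Y_int[OF Suc.prems] C_ind[OF Suc.prems] by simp
    also have "\<dots> \<le> expectation (\<lambda>\<omega>. Y t \<omega> * Z \<omega> + exp c * indicator (C t) \<omega>)"
    proof (rule integral_mono)
      show "integrable M (\<lambda>\<omega>. Y (Suc t) \<omega> + exp c * indicator (C (Suc t)) \<omega>)"
        using Y_int[OF Suc.prems] C_ind[OF Suc.prems] by simp
      show "integrable M (\<lambda>\<omega>. Y t \<omega> * Z \<omega> + exp c * indicator (C t) \<omega>)"
        using YZ_int C_ind[OF t(1)] by simp
      fix \<omega> assume \<omega>: "\<omega> \<in> space M"
      have C_Suc: "\<omega> \<in> C (Suc t) \<longleftrightarrow> \<omega> \<in> C t \<or> c \<le> L (Suc t) \<omega>"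
        using \<omega> unfolding C_def by (blast intro: le_SucI elim: le_SucE)
      have YZ: "Y t \<omega> * Z \<omega> = exp (L (Suc t) \<omega>) * indicator (space M - C t) \<omega>"
        by (simp add: Y_alt[OF \<omega>] Z_def LS exp_add)
      show "Y (Suc t) \<omega> + exp c * indicator (C (Suc t)) \<omega> \<le> Y t \<omega> * Z \<omega> + exp c * indicator (C t) \<omega>"
        unfolding YZ unfolding Y_alt[OF \<omega>] using \<omega> C_Suc by (auto simp: indicator_def)
    qed
    also have "\<dots> = expectation (Y t) * expectation Z + exp c * prob (C t)"
      using YZ_int C_ind[OF t(1)]
      by (subst indep_var_lebesgue_integral[OF ind Y_int[OF t(1)] Z(1), symmetric]) simp
    also have "\<dots> \<le> expectation (Y t) * 1 + exp c * prob (C t)"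
      by (intro add_right_mono mult_left_mono Z) (auto simp: Y_def)
    also have "\<dots> \<le> 1" using Suc.IH t by simp
    finally show ?case .
  qed
  have "0 \<le> expectation (Y N)" by (rule Bochner_Integration.integral_nonneg) (auto simp: Y_def)
  hence "exp c * prob (C N) \<le> 1" using claim[of N] by simp
  hence "prob (C N) \<le> exp (- c)" by (simp add: exp_minus field_simps)
  thus ?thesis by (simp add: C_def L_def)
qed

text \<open>
  The line in \<open>line_crossing_bound\<close> with slope parameter \<open>l = 4 * x / V\<close> lies below the level \<open>x\<close> until time
  \<open>V\<close>, and this slope gives the best exponent.
\<close>

lemma maximal_hoeffding:
  assumes inj: "inj_on \<sigma> {..<N}" and ran: "\<sigma> ` {..<N} \<subseteq> I"
    and V: "V > 0" "real N \<le> V" and x: "x > 0"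
  shows "prob {\<omega> \<in> space M. \<exists>t\<le>N. x \<le> walk \<sigma> t \<omega>} \<le> exp (- (2 * x\<^sup>2 / V))"
proof -
  define l where "l = 4 * x / V"
  have l: "l > 0" using V x by (simp add: l_def)
  have c: "2 * x\<^sup>2 / V = l * x - V * (l\<^sup>2 / 8)"
    using V by (simp add: l_def field_simps power2_eq_square)
  let ?E = "\<lambda>t. {\<omega> \<in> space M. 2 * x\<^sup>2 / V \<le> l * walk \<sigma> t \<omega> - real t * (l\<^sup>2 / 8)}"
  have "{\<omega> \<in> space M. \<exists>t\<le>N. x \<le> walk \<sigma> t \<omega>} \<subseteq> (\<Union>t\<in>{..N}. ?E t)"
  proof safe
    fix \<omega> t assume \<omega>: "\<omega> \<in> space M" and t: "t \<le> N" and le: "x \<le> walk \<sigma> t \<omega>"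
    have "real t * (l\<^sup>2 / 8) \<le> V * (l\<^sup>2 / 8)"
      using t V by (intro mult_right_mono) auto
    moreover have "l * x \<le> l * walk \<sigma> t \<omega>" using le l by simp
    ultimately show "\<omega> \<in> (\<Union>t\<in>{..N}. ?E t)" using \<omega> t c by fastforce
  qed
  moreover have "(\<Union>t\<in>{..N}. ?E t) \<in> events"
  proof (intro sets.finite_UN)
    fix t assume "t \<in> {..N}"
    hence [measurable]: "walk \<sigma> t \<in> borel_measurable M" using measurable_walk[OF ran] by auto
    show "?E t \<in> events" by measurable
  qed auto
  ultimately have "prob {\<omega> \<in> space M. \<exists>t\<le>N. x \<le> walk \<sigma> t \<omega>} \<le> prob (\<Union>t\<in>{..N}. ?E t)"
    by (rule finite_measure_mono)
  also have "(\<Union>t\<in>{..N}. ?E t)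
      = {\<omega> \<in> space M. \<exists>t\<le>N. 2 * x\<^sup>2 / V \<le> l * walk \<sigma> t \<omega> - real t * (l\<^sup>2 / 8)}" by auto
  also have "prob \<dots> \<le> exp (- (2 * x\<^sup>2 / V))" using line_crossing_bound[OF inj ran l] .
  finally show ?thesis .
qed

lemma measurable_maximal_event:
  assumes "\<sigma> ` {..<N} \<subseteq> I" and T: "T \<subseteq> {..N}"
  shows "{\<omega> \<in> space M. \<exists>t\<in>T. b t \<le> walk \<sigma> t \<omega>} \<in> events"
proof -
  have "{\<omega> \<in> space M. b t \<le> walk \<sigma> t \<omega>} \<in> events" if "t \<in> T" for t
  proof -
    have [measurable]: "walk \<sigma> t \<in> borel_measurable M"
      using measurable_walk[OF assms(1)] T that by auto
    show ?thesis by measurable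
  qed
  hence "(\<Union>t\<in>T. {\<omega> \<in> space M. b t \<le> walk \<sigma> t \<omega>}) \<in> events"
    using finite_subset[OF T] by (intro sets.finite_UN) auto
  also have "(\<Union>t\<in>T. {\<omega> \<in> space M. b t \<le> walk \<sigma> t \<omega>})
      = {\<omega> \<in> space M. \<exists>t\<in>T. b t \<le> walk \<sigma> t \<omega>}" by auto
  finally show ?thesis .
qed

text \<open>
  Cut time into blocks \<open>2 ^ k \<le> t < 2 ^ (k + 1)\<close>. On a block the boundary is at least its value at
  \<open>2 ^ k\<close>, so a crossing makes the maximum of the walk up to time \<open>2 ^ (k + 1)\<close> reach that value.
  The maximal inequality bounds this by a power of \<open>\<delta> / ((k + 1) * ln 2)\<close>, which is summable in \<open>k\<close>.
\<close>

lemma finite_lil: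
  assumes inj: "inj_on \<sigma> {..<N}" and ran: "\<sigma> ` {..<N} \<subseteq> I"
    and \<delta>: "0 < \<delta>" "\<delta> < ln 2 / exp 1"
  shows "prob {\<omega> \<in> space M. \<exists>t\<in>{1..N}. lil_boundary \<delta> t \<le> walk \<sigma> t \<omega>} \<le> 2 * (\<delta> / ln 2)\<^sup>2"
proof -
  define r where "r = \<delta> / ln 2"
  have "r < 1 / exp 1" using \<delta> by (simp add: r_def field_simps)
  also have "(1::real) / exp 1 \<le> 1" by simp
  finally have r: "0 < r" "r < 1" using \<delta> by (auto simp: r_def)
  define E where "E k = {\<omega> \<in> space M. \<exists>t\<in>{..min N (2 ^ (k + 1))}. lil_boundary \<delta> (2 ^ k) \<le> walk \<sigma> t \<omega>}" for k :: nat
  have E_meas: "E k \<in> events" for k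
    unfolding E_def by (rule measurable_maximal_event[OF ran]) auto
  have E_prob: "prob (E k) \<le> r\<^sup>2 * (1 / (real k + 1)\<^sup>2)" for k
  proof -
    let ?N = "min N (2 ^ (k + 1))"
    define g where "g = ln (ln (2 * real (2 ^ k))) + ln (1 / \<delta>)"
    have g: "1 < g" unfolding g_def using lil_exponent_gt_1[OF \<delta>, of "2 ^ k"] by simp
    have "ln (2 * real (2 ^ k)) = (real k + 1) * ln 2"
      by (simp add: ln_mult ln_realpow algebra_simps)
    hence "exp g = (real k + 1) * ln 2 / \<delta>"
      using \<delta> by (simp add: g_def exp_add)
    hence eg: "exp (- g) = r / (real k + 1)" by (simp add: exp_minus r_def)
    have "prob (E k) \<le> exp (- (2 * (lil_boundary \<delta> (2 ^ k))\<^sup>2 / 2 ^ (k + 1)))"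
      unfolding E_def Bex_def atMost_iff
    proof (rule maximal_hoeffding)
      show "inj_on \<sigma> {..<?N}" using inj by (rule inj_on_subset) auto
      show "\<sigma> ` {..<?N} \<subseteq> I" using ran by auto
      have "real ?N \<le> real (2 ^ (k + 1))" by (subst of_nat_le_iff) simp
      thus "real ?N \<le> 2 ^ (k + 1)" by simp
      show "lil_boundary \<delta> (2 ^ k) > 0" using g by (simp add: lil_boundary_def g_def)
    qed auto
    also have "2 * (lil_boundary \<delta> (2 ^ k))\<^sup>2 / 2 ^ (k + 1) = 4 * g"
      using g by (simp add: lil_boundary_def g_def power_mult_distrib)
    also have "exp (- (4 * g)) \<le> exp (- (2 * g))" using g by simp
    \<comment> \<open>The fourth power of \<open>exp (- g)\<close> decays faster than needed; its square is already summable over \<open>k\<close>.\<close>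
    also have "\<dots> = (exp (- g))\<^sup>2" by (simp add: exp_double[symmetric] mult.commute)
    also have "\<dots> = r\<^sup>2 * (1 / (real k + 1)\<^sup>2)" unfolding eg by (simp add: power_divide)
    finally show ?thesis .
  qed
  have "{\<omega> \<in> space M. \<exists>t\<in>{1..N}. lil_boundary \<delta> t \<le> walk \<sigma> t \<omega>} \<subseteq> (\<Union>k<N. E k)"
  proof safe
    fix \<omega> t assume \<omega>: "\<omega> \<in> space M" and t: "t \<in> {1..N}" and le: "lil_boundary \<delta> t \<le> walk \<sigma> t \<omega>"
    obtain k where k: "2 ^ k \<le> t" "t < 2 ^ (k + 1)"
      using ex_power_ivl1[of 2 t] t by auto
    have "t \<le> N" using t by simp
    hence "k < N" using less_exp[of k] k(1) by linarith
    moreover have "lil_boundary \<delta> (2 ^ k) \<le> lil_boundary \<delta> t"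
      by (rule lil_boundary_mono[OF \<delta>]) (use k in auto)
    hence "\<omega> \<in> E k" unfolding E_def using \<omega> t k le by force
    ultimately show "\<omega> \<in> (\<Union>k<N. E k)" by auto
  qed
  hence "prob {\<omega> \<in> space M. \<exists>t\<in>{1..N}. lil_boundary \<delta> t \<le> walk \<sigma> t \<omega>} \<le> prob (\<Union>k<N. E k)"
    using E_meas by (intro finite_measure_mono) auto
  also have "\<dots> \<le> (\<Sum>k<N. prob (E k))"
    by (rule finite_measure_subadditive_finite) (use E_meas in auto)
  also have "\<dots> \<le> (\<Sum>k<N. r\<^sup>2 * (1 / (real k + 1)\<^sup>2))" by (intro sum_mono E_prob)
  also have "\<dots> = r\<^sup>2 * (\<Sum>k<N. 1 / (real k + 1)\<^sup>2)" by (simp add: sum_distrib_left)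
  also have "\<dots> \<le> r\<^sup>2 * 2" by (intro mult_left_mono sum_inverse_squares_le_2) auto
  finally show ?thesis by (simp add: r_def)
qed

end

section \<open>Local optimality of the fused fit\<close>

lemma quantile_loss_increment:
  "eventually (\<lambda>\<eta>. quantile_loss \<tau> (x + \<eta>) - quantile_loss \<tau> x = (\<tau> - of_bool (x < 0)) * \<eta>) (at_right 0)"
  by (rule eventually_at_rightI[of 0 "if x < 0 then - x else 1"])
     (auto simp: quantile_loss_def algebra_simps split: if_splits)

text \<open>
  First-order optimality for lowering the fit on \<open>{s..t}\<close> by a small \<open>\<eta>\<close>. The loss changes at rate
  \<open>\<tau>\<close> at each observation that is not below the fit and at rate \<open>\<tau> - 1\<close> at the others. The penalty changes only at
  the two ends, at rate \<open>- 1\<close> where the fit drops when leaving the interval and at most \<open>1\<close> anywhere.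
  The loss is piecewise linear, so that a single small \<open>\<eta>\<close> makes all these rates valid at once.
\<close>

lemma interval_optimality:
  assumes opt: "is_arg_min (fused_objective \<tau> lam n y) (\<lambda>_. True) h" and lam: "lam \<ge> 0"
    and st: "1 \<le> s" "s \<le> t" "t \<le> n"
    and left: "c\<^sub>l = 1 \<or> c\<^sub>l = - 1 \<and> 1 < s \<and> h (s - 1) < h s"
    and right: "c\<^sub>r = 1 \<or> c\<^sub>r = - 1 \<and> t < n \<and> h (t + 1) < h t"
  shows "(\<Sum>j=s..t. of_bool (y j < h j)) \<le> \<tau> * (real t - real s + 1) + lam * (c\<^sub>l + c\<^sub>r)"
proof -
  have "eventually (\<lambda>\<eta>. \<bar>h (s - 1) - (h s - \<eta>)\<bar> - \<bar>h (s - 1) - h s\<bar> \<le> c\<^sub>l * \<eta>) (at_right 0)"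
    by (rule eventually_at_rightI[of 0 "if c\<^sub>l = 1 then 1 else h s - h (s - 1)"])
       (use left in auto)
  moreover have "eventually (\<lambda>\<eta>. \<bar>h t - \<eta> - h (t + 1)\<bar> - \<bar>h t - h (t + 1)\<bar> \<le> c\<^sub>r * \<eta>) (at_right 0)"
    by (rule eventually_at_rightI[of 0 "if c\<^sub>r = 1 then 1 else h t - h (t + 1)"])
       (use right in auto)
  moreover have "eventually (\<lambda>\<eta>. \<forall>j\<in>{s..t}. quantile_loss \<tau> (y j - h j + \<eta>) - quantile_loss \<tau> (y j - h j)
      = (\<tau> - of_bool (y j - h j < 0)) * \<eta>) (at_right 0)"
    by (intro eventually_ball_finite ballI quantile_loss_increment) auto
  moreover have "eventually (\<lambda>\<eta>::real. 0 < \<eta>) (at_right 0)" by (rule eventually_at_right_less)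
  ultimately have "eventually (\<lambda>\<eta>. \<bar>h (s - 1) - (h s - \<eta>)\<bar> - \<bar>h (s - 1) - h s\<bar> \<le> c\<^sub>l * \<eta>
      \<and> \<bar>h t - \<eta> - h (t + 1)\<bar> - \<bar>h t - h (t + 1)\<bar> \<le> c\<^sub>r * \<eta>
      \<and> (\<forall>j\<in>{s..t}. quantile_loss \<tau> (y j - h j + \<eta>) - quantile_loss \<tau> (y j - h j)
            = (\<tau> - of_bool (y j - h j < 0)) * \<eta>) \<and> 0 < \<eta>) (at_right 0)"
    by (intro eventually_conj)
  then obtain \<eta> where tv_left: "\<bar>h (s - 1) - (h s - \<eta>)\<bar> - \<bar>h (s - 1) - h s\<bar> \<le> c\<^sub>l * \<eta>"
    and tv_right: "\<bar>h t - \<eta> - h (t + 1)\<bar> - \<bar>h t - h (t + 1)\<bar> \<le> c\<^sub>r * \<eta>"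
    and loss: "\<And>j. j \<in> {s..t} \<Longrightarrow> quantile_loss \<tau> (y j - h j + \<eta>) - quantile_loss \<tau> (y j - h j)
            = (\<tau> - of_bool (y j - h j < 0)) * \<eta>" and \<eta>: "0 < \<eta>"
    using eventually_happens[of _ "at_right (0::real)"] by fastforce
  define g where "g j = h j - \<eta> * of_bool (j \<in> {s..t})" for j
  have "fused_objective \<tau> lam n y h \<le> fused_objective \<tau> lam n y g"
    using opt by (auto simp: is_arg_min_def not_less)
  hence "0 \<le> (\<Sum>j=1..n. quantile_loss \<tau> (y j - g j) - quantile_loss \<tau> (y j - h j))
      + lam * (\<Sum>j=1..n-1. \<bar>g j - g (j + 1)\<bar> - \<bar>h j - h (j + 1)\<bar>)"
    by (simp add: fused_objective_def sum_subtractf algebra_simps)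
  also have "(\<Sum>j=1..n. quantile_loss \<tau> (y j - g j) - quantile_loss \<tau> (y j - h j))
      = (\<Sum>j=s..t. quantile_loss \<tau> (y j - g j) - quantile_loss \<tau> (y j - h j))"
    by (rule sum.mono_neutral_right) (use st in \<open>auto simp: g_def\<close>)
  also have "\<dots> = (\<Sum>j=s..t. (\<tau> - of_bool (y j < h j)) * \<eta>)"
    using loss by (intro sum.cong) (auto simp: g_def algebra_simps)
  also have "\<dots> = (\<tau> * (real t - real s + 1) - (\<Sum>j=s..t. of_bool (y j < h j))) * \<eta>"
    using st by (simp add: sum_distrib_right[symmetric] sum_subtractf of_nat_diff algebra_simps)
  also have "(\<Sum>j=1..n-1. \<bar>g j - g (j + 1)\<bar> - \<bar>h j - h (j + 1)\<bar>)
      \<le> (\<Sum>j=1..n-1. (if j = s - 1 then c\<^sub>l * \<eta> else 0) + (if j = t then c\<^sub>r * \<eta> else 0))"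
  proof (rule sum_mono)
    fix j assume j: "j \<in> {1..n-1}"
    consider "j = s - 1" | "j = t" | "j \<noteq> s - 1" "j \<noteq> t" by blast
    thus "\<bar>g j - g (j + 1)\<bar> - \<bar>h j - h (j + 1)\<bar>
        \<le> (if j = s - 1 then c\<^sub>l * \<eta> else 0) + (if j = t then c\<^sub>r * \<eta> else 0)"
    proof cases
      case 1
      hence "j + 1 = s" using j st by auto
      thus ?thesis using tv_left 1 j st by (auto simp: g_def)
    next
      case 2
      thus ?thesis using tv_right j st by (auto simp: g_def)
    next
      case 3
      hence "j \<in> {s..t} \<longleftrightarrow> j + 1 \<in> {s..t}" using j st by auto
      thus ?thesis using 3 by (auto simp: g_def)
    qed
  qed
  also have "\<dots> = (if s - 1 \<in> {1..n-1} then c\<^sub>l * \<eta> else 0) + (if t \<in> {1..n-1} then c\<^sub>r * \<eta> else 0)"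
    by (simp add: sum.distrib)
  \<comment> \<open>At an end of the whole index range there is no penalty term, and then the rate is bounded by \<open>1\<close>.\<close>
  also have "\<dots> \<le> c\<^sub>l * \<eta> + c\<^sub>r * \<eta>"
    using left right \<eta> st by (intro add_mono) auto
  finally have "0 \<le> (\<tau> * (real t - real s + 1) - (\<Sum>j=s..t. of_bool (y j < h j))) * \<eta>
      + lam * (c\<^sub>l * \<eta> + c\<^sub>r * \<eta>)"
    using lam by (simp add: mult_left_mono)
  also have "\<dots> = (\<tau> * (real t - real s + 1) - (\<Sum>j=s..t. of_bool (y j < h j)) + lam * (c\<^sub>l + c\<^sub>r)) * \<eta>"
    by (simp add: algebra_simps)
  finally show ?thesis using \<eta> by (simp add: zero_le_mult_iff)
qed

lemma superlevel_component:
  fixes h :: "nat \<Rightarrow> real"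
  assumes "a \<le> i" "i \<le> b"
  obtains s t where "a \<le> s" "s \<le> i" "i \<le> t" "t \<le> b" "\<And>j. j \<in> {s..t} \<Longrightarrow> h i \<le> h j"
    "s = a \<or> h (s - 1) < h i" "t = b \<or> h (t + 1) < h i"
proof -
  define L where "L s \<longleftrightarrow> a \<le> s \<and> s \<le> i \<and> (\<forall>j\<in>{s..i}. h i \<le> h j)" for s
  define R where "R t \<longleftrightarrow> i \<le> t \<and> t \<le> b \<and> (\<forall>j\<in>{i..t}. h i \<le> h j)" for t
  define s where "s = (LEAST s. L s)"
  define t where "t = (GREATEST t. R t)"
  have "L i" "R i" using assms by (auto simp: L_def R_def)
  have s: "L s" unfolding s_def by (rule LeastI[of L i]) fact
  have t: "R t" unfolding t_def by (rule GreatestI_nat[of R i b]) (use \<open>R i\<close> in \<open>auto simp: R_def\<close>)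
  have "s = a \<or> h (s - 1) < h i"
  proof (rule ccontr)
    assume contra: "\<not> (s = a \<or> h (s - 1) < h i)"
    have "h i \<le> h j" if "j \<in> {s - 1..i}" for j
      using that contra s by (cases "j = s - 1") (auto simp: L_def)
    hence "L (s - 1)" using contra s by (auto simp: L_def)
    hence "s \<le> s - 1" unfolding s_def by (rule Least_le)
    thus False using contra s by (auto simp: L_def)
  qed
  moreover have "t = b \<or> h (t + 1) < h i"
  proof (rule ccontr)
    assume contra: "\<not> (t = b \<or> h (t + 1) < h i)"
    have "h i \<le> h j" if "j \<in> {i..t + 1}" for j
      using that contra t by (cases "j = t + 1") (auto simp: R_def)
    hence "R (t + 1)" using contra t by (auto simp: R_def)
    hence "t + 1 \<le> t" unfolding t_def by (rule Greatest_le_nat[of R _ b]) (auto simp: R_def)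
    thus False by simp
  qed
  moreover have "h i \<le> h j" if "j \<in> {s..t}" for j
    using that s t by (cases "j \<le> i") (auto simp: L_def R_def)
  ultimately show ?thesis using that s t by (auto simp: L_def R_def)
qed

text \<open>
  Lowering the fit on the component around \<open>i\<close> of the superlevel set inside \<open>{a..b}\<close>. The sign of the
  penalty term tells whether the component reaches an end of \<open>{a..b}\<close>: a component strictly inside gains
  \<open>2 * lam\<close>, a component touching one end is neutral, and only \<open>{a..b}\<close> itself loses \<open>2 * lam\<close>.
\<close>

lemma few_observations_below_fit:
  assumes opt: "is_arg_min (fused_objective \<tau> lam n y) (\<lambda>_. True) h" and lam: "lam \<ge> 0"
    and ab: "1 \<le> a" "a \<le> i" "i \<le> b" "b \<le> n"
  obtains s t where "a \<le> s" "s \<le> i" "i \<le> t" "t \<le> b"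
    "(\<Sum>j=s..t. of_bool (y j < h i)) \<le> \<tau> * (real t - real s + 1)
       + lam * ((if s = a then 1 else - 1) + (if t = b then 1 else - 1))"
proof -
  obtain s t where st: "a \<le> s" "s \<le> i" "i \<le> t" "t \<le> b" "\<And>j. j \<in> {s..t} \<Longrightarrow> h i \<le> h j"
    "s = a \<or> h (s - 1) < h i" "t = b \<or> h (t + 1) < h i"
    using superlevel_component[OF ab(2,3)] by metis
  have ends: "s = a \<or> h (s - 1) < h s" "t = b \<or> h (t + 1) < h t"
    using st(5)[of s] st(5)[of t] st(2,3,6,7) by auto
  have "(\<Sum>j=s..t. of_bool (y j < h i) :: real) \<le> (\<Sum>j=s..t. of_bool (y j < h j))"
    using st(5) by (intro sum_mono) (auto simp: of_bool_def intro: less_le_trans)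
  also have "\<dots> \<le> \<tau> * (real t - real s + 1)
       + lam * ((if s = a then 1 else - 1) + (if t = b then 1 else - 1))"
    by (rule interval_optimality[OF opt lam]) (use st(1-4) ends ab in auto)
  finally show ?thesis using that st by metis
qed

section \<open>Comparing interval sums with the error bound\<close>

text \<open>
  The ratio \<open>ln (ln (2 * x)) / x\<close> decreases from \<open>x = 3\<close> on because \<open>u * ln u \<ge> 1\<close> for
  \<open>u = ln (2 * x) \<ge> ln 6\<close>. That inequality changes sign at \<open>u = 1.76...\<close>, while \<open>ln 6 = 1.79...\<close>;
  the rational \<open>16 / 9\<close> lies between the two, and its reciprocal \<open>9 / 16\<close> is a convenient bound for its
  logarithm. Both bounds reduce to comparing an integer power of \<open>exp 1 < 2.72\<close> with a rational.
\<close>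

lemma nine_le_sixteen_ln_ratio: "9 / 16 \<le> ln (16 / 9 :: real)"
proof -
  have "exp (9 / 16 :: real) ^ 16 = exp 1 ^ 9" by (simp flip: exp_of_nat_mult)
  also have "\<dots> \<le> (272 / 100 :: real) ^ 9" using e_less_272 by (intro power_mono) auto
  also have "\<dots> \<le> (16 / 9) ^ 16" by (simp add: field_simps)
  finally have "exp (9 / 16 :: real) \<le> 16 / 9" by (rule power_le_imp_le_base[of _ 15, simplified]) auto
  thus ?thesis by (subst ln_ge_iff) simp_all
qed

lemma sixteen_ninths_le_ln_6: "16 / 9 \<le> ln (6 :: real)"
proof -
  have "exp (16 / 9 :: real) ^ 9 = exp 1 ^ 16" by (simp flip: exp_of_nat_mult)
  also have "\<dots> \<le> (272 / 100 :: real) ^ 16" using e_less_272 by (intro power_mono) auto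
  also have "\<dots> \<le> 6 ^ 9" by (simp add: field_simps)
  finally have "exp (16 / 9 :: real) \<le> 6" by (rule power_le_imp_le_base[of _ 8, simplified]) auto
  thus ?thesis by (subst ln_ge_iff) simp_all
qed

lemma mult_ln_ge_1:
  fixes u :: real
  assumes "16 / 9 \<le> u"
  shows "1 \<le> u * ln u"
proof -
  have "ln (16 / 9) \<le> ln u" using assms by (intro ln_mono) auto
  hence "9 / 16 \<le> ln u" using nine_le_sixteen_ln_ratio by linarith
  hence "(16 / 9) * (9 / 16) \<le> u * ln u" using assms by (intro mult_mono) auto
  thus ?thesis by simp
qed

text \<open>
  With \<open>u = ln (2 * x)\<close>, the tangent of \<open>ln\<close> at \<open>u\<close> bounds \<open>ln (ln (2 * y))\<close> by
  \<open>ln u + (y / x - 1) / u\<close>, and \<open>1 / u \<le> ln u\<close> turns this into \<open>(y / x) * ln u\<close>.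
\<close>

lemma loglog_div_antimono:
  fixes x y :: real
  assumes "3 \<le> x" "x \<le> y"
  shows "ln (ln (2 * y)) / y \<le> ln (ln (2 * x)) / x"
proof -
  define u where "u = ln (2 * x)"
  have "ln 6 \<le> u" unfolding u_def using assms by (intro ln_mono) auto
  hence u: "16 / 9 \<le> u" using sixteen_ninths_le_ln_6 by linarith
  have "ln (2 * y) > 0" using assms by simp
  hence "ln (ln (2 * y)) = ln u + ln (ln (2 * y) / u)" using u by (simp add: ln_div)
  also have "\<dots> \<le> ln u + (ln (2 * y) / u - 1)"
    using u \<open>ln (2 * y) > 0\<close> by (intro add_left_mono ln_le_minus_one) auto
  also have "ln (2 * y) / u - 1 = ln (y / x) / u"
    using assms u by (simp add: u_def ln_div ln_mult field_simps)
  also have "ln u + \<dots> \<le> ln u + (y / x - 1) * (1 / u)"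
    using ln_le_minus_one[of "y / x"] assms u by (simp add: divide_right_mono)
  also have "\<dots> \<le> ln u + (y / x - 1) * ln u"
    using mult_ln_ge_1[OF u] u assms by (intro add_left_mono mult_left_mono) (auto simp: field_simps)
  also have "\<dots> = y * (ln u / x)" by (simp add: algebra_simps)
  finally show ?thesis using assms by (simp add: u_def field_simps)
qed

text \<open>
  The cut-off at three is what makes this comparison hold for all lengths: at lengths one and two the ratio
  is below its value at three, and it decreases afterwards.
\<close>

lemma loglog_div_le:
  fixes l d :: nat
  assumes "1 \<le> l" "d \<le> l"
  shows "ln (ln (2 * real l)) / real l \<le> ln (ln (2 * real (max 3 d))) / real (max 3 d)"
proof (cases "3 \<le> l")
  case True
  thus ?thesis using assms by (intro loglog_div_antimono) auto
next
  case False
  hence [simp]: "max 3 d = 3" using assms by auto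
  have "ln (16 / 9) \<le> ln (ln (6 :: real))" using sixteen_ninths_le_ln_6 by (intro ln_mono) auto
  hence rhs: "9 / 16 \<le> ln (ln (6 :: real))" using nine_le_sixteen_ln_ratio by linarith
  consider "l = 1" | "l = 2" using False assms by linarith
  thus ?thesis
  proof cases
    case 1
    have "ln (ln (2 :: real)) \<le> 0" using ln_2_less_1 by simp
    hence "ln (ln 2) \<le> ln (ln (6 :: real)) / 3" using rhs by linarith
    thus ?thesis using 1 by simp
  next
    case 2
    have "ln (4 :: real) = 2 * ln 2" using ln_realpow[of 2 2] by simp
    also have "\<dots> \<le> 2 * (25 / 36)" using ln2_le_25_over_36 by simp
    also have "\<dots> \<le> 1 + 3 / 8 + (3 / 8)\<^sup>2 / 2" by (simp add: power2_eq_square)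
    also have "\<dots> \<le> exp (3 / 8)" by (rule exp_lower_Taylor_quadratic) simp
    finally have "ln (ln (4 :: real)) \<le> ln (exp (3 / 8))" by (intro ln_mono) auto
    hence "ln (ln (4 :: real)) \<le> 3 / 8" by simp
    thus ?thesis using 2 rhs by simp
  qed
qed

text \<open>
  The quantity \<open>B_quantile\<close> with the piece reduced to the two numbers it depends on, so that the
  probabilistic argument can run on a bare interval.
\<close>

definition fit_error_bound :: "real \<Rightarrow> nat \<Rightarrow> nat \<Rightarrow> real \<Rightarrow> real" where
  "fit_error_bound lam m d \<delta> =
     2 * (sqrt (ln (ln (2 * real (max 3 d))) / real (max 3 d)) + sqrt (ln (1 / \<delta>) / real d))
     + (ln (ln (2 * real m)) + ln (1 / \<delta>)) / lam + (sqrt (real m * ln (1 / \<delta>)) + 2 * lam) / real m"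

text \<open>
  Divided by the length, the boundary is \<open>2 * sqrt (ln (ln (2 * l)) / l + ln (1 / \<delta>) / l)\<close>; the first
  quotient is at most its value at \<open>max 3 d\<close>, the second at most its value at \<open>d\<close>, and the root is
  subadditive.
\<close>

lemma lil_boundary_le_mean_bound:
  assumes \<delta>: "0 < \<delta>" "\<delta> < 1" and d: "1 \<le> d" "d \<le> l"
  shows "lil_boundary \<delta> l \<le> real l * (2 * (sqrt (ln (ln (2 * real (max 3 d))) / real (max 3 d))
           + sqrt (ln (1 / \<delta>) / real d)))"
proof -
  define Q where "Q = ln (ln (2 * real (max 3 d))) / real (max 3 d)"
  define G where "G = ln (1 / \<delta>)"
  have G: "G > 0" using \<delta> by (simp add: G_def)
  have l: "real l > 0" using d by simp
  have "ln (16 / 9) \<le> ln (ln (2 * real (max 3 d)))"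
  proof (rule ln_mono)
    have "ln 6 \<le> ln (2 * real (max 3 d))" by (intro ln_mono) auto
    thus "16 / 9 \<le> ln (2 * real (max 3 d))" using sixteen_ninths_le_ln_6 by linarith
  qed auto
  hence Q: "Q \<ge> 0" using nine_le_sixteen_ln_ratio by (simp add: Q_def)
  have "lil_boundary \<delta> l = 2 * sqrt ((real l)\<^sup>2 * (ln (ln (2 * real l)) / real l + G / real l))"
    using l by (simp add: lil_boundary_def G_def power2_eq_square field_simps)
  also have "\<dots> = real l * (2 * sqrt (ln (ln (2 * real l)) / real l + G / real l))"
    by (simp add: real_sqrt_mult)
  also have "\<dots> \<le> real l * (2 * sqrt (Q + G / real d))"
  proof -
    have "ln (ln (2 * real l)) / real l \<le> Q" unfolding Q_def using d by (intro loglog_div_le) auto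
    moreover have "G / real l \<le> G / real d" using d G by (intro divide_left_mono) auto
    ultimately show ?thesis by (intro mult_left_mono real_sqrt_le_mono add_mono) auto
  qed
  also have "\<dots> \<le> real l * (2 * (sqrt Q + sqrt (G / real d)))"
    using Q G by (intro mult_left_mono sqrt_add_le_add_sqrt) auto
  finally show ?thesis by (simp add: Q_def G_def)
qed

text \<open>
  Each of the three summands of the bound serves one kind of interval \<open>{s..t}\<close> around \<open>i\<close>. The whole piece
  is handled by the last summand, which contains the \<open>2 * lam\<close> lost in the penalty. An interval touching
  one end of the piece has length at least \<open>d\<close>, and a single walk from that end reaches it, so the first summand suffices.
  An interval inside is split at \<open>i\<close> into two walks leaving \<open>i\<close>; by the inequality of arithmetic and
  geometric means each costs at most \<open>lam\<close> plus its length times the middle summand, and the two copies of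
  \<open>lam\<close> are exactly the gain in the penalty. The summands that are left over make the inequality
  strict.
\<close>

lemma interval_sums_below_bound:
  fixes x :: "nat \<Rightarrow> real"
  assumes lam: "lam > 0" and \<delta>: "0 < \<delta>" "\<delta> < ln 2 / exp 1"
    and ab: "a \<le> i" "i \<le> b"
    and m: "m = b + 1 - a" and d: "d = min (i + 1 - a) (b + 1 - i)"
    and whole: "(\<Sum>j<m. x (a + j)) < sqrt (real m * ln (1 / \<delta>))"
    and from_left: "\<And>t. t \<in> {1..m} \<Longrightarrow> (\<Sum>j<t. x (a + j)) < lil_boundary \<delta> t"
    and from_right: "\<And>t. t \<in> {1..m} \<Longrightarrow> (\<Sum>j<t. x (b - j)) < lil_boundary \<delta> t"
    and down: "\<And>t. t \<in> {1..i + 1 - a} \<Longrightarrow> (\<Sum>j<t. x (i - j)) < lil_boundary \<delta> t"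
    and up: "\<And>t. t \<in> {1..b - i} \<Longrightarrow> (\<Sum>j<t. x (i + 1 + j)) < lil_boundary \<delta> t"
    and st: "a \<le> s" "s \<le> i" "i \<le> t" "t \<le> b"
  shows "(\<Sum>j=s..t. x j) + lam * ((if s = a then 1 else - 1) + (if t = b then 1 else - 1))
    < real (t + 1 - s) * fit_error_bound lam m d \<delta>"
proof -
  define l where "l = t + 1 - s"
  define G where "G = ln (1 / \<delta>)"
  define H where "H = ln (ln (2 * real m)) + G"
  define P1 where "P1 = 2 * (sqrt (ln (ln (2 * real (max 3 d))) / real (max 3 d)) + sqrt (G / real d))"
  define P2 where "P2 = H / lam"
  define P3 where "P3 = (sqrt (real m * G) + 2 * lam) / real m"
  have B: "fit_error_bound lam m d \<delta> = P1 + P2 + P3"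
    by (simp add: fit_error_bound_def P1_def P2_def P3_def H_def G_def)
  have "ln 2 / exp 1 \<le> ln (2::real) / 1" by (intro divide_left_mono) auto
  hence \<delta>1: "\<delta> < 1" using \<delta> ln_2_less_1 by linarith
  have m1: "1 \<le> m" and d1: "1 \<le> d" and l1: "1 \<le> l" and lm: "l \<le> m"
    using ab st by (auto simp: m d l_def)
  have G: "G > 0" using \<delta> \<delta>1 by (simp add: G_def)
  have H: "H > 1" unfolding H_def G_def using lil_exponent_gt_1[OF \<delta>] m1 by simp
  have P2: "P2 > 0" using H lam by (simp add: P2_def)
  have "sqrt (real m * G) \<ge> 0" using G by simp
  hence P3: "P3 > 0" unfolding P3_def using lam m1 by (intro divide_pos_pos add_nonneg_pos) auto
  have lil_P1: "lil_boundary \<delta> l \<le> real l * P1" if "d \<le> l"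
    using lil_boundary_le_mean_bound[OF \<delta>(1) \<delta>1 d1 that] by (simp add: P1_def G_def)
  have "0 \<le> lil_boundary \<delta> m"
    using H m1 by (simp add: lil_boundary_def H_def G_def)
  also have "\<dots> \<le> real m * P1"
    using lil_boundary_le_mean_bound[OF \<delta>(1) \<delta>1 d1, of m] lm ab by (simp add: P1_def G_def m d)
  finally have P1: "P1 \<ge> 0" using m1 by (simp add: zero_le_mult_iff)
  have lB: "real l * (P1 + P2 + P3) = real l * P1 + real l * P2 + real l * P3"
    by (simp add: algebra_simps)
  have pos: "real l * P1 \<ge> 0" "real l * P2 > 0" "real l * P3 > 0" using P1 P2 P3 l1 by auto
  have forward: "(\<Sum>j<v + 1 - u. x (u + j)) = (\<Sum>j=u..v. x j)" for u v
    by (rule sum.reindex_bij_witness[of _ "\<lambda>j. j - u" "\<lambda>j. u + j"]) auto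
  have backward: "(\<Sum>j<v + 1 - u. x (v - j)) = (\<Sum>j=u..v. x j)" for u v
    by (rule sum.reindex_bij_witness[of _ "\<lambda>j. v - j" "\<lambda>j. v - j"]) auto
  have "(\<Sum>j=s..t. x j) + lam * ((if s = a then 1 else - 1) + (if t = b then 1 else - 1))
      < real l * (P1 + P2 + P3)"
  proof -
    consider "s = a" "t = b" | "s = a" "t \<noteq> b" | "s \<noteq> a" "t = b" | "s \<noteq> a" "t \<noteq> b" by blast
    thus ?thesis
    proof cases
      case 1
      hence "l = m" by (simp add: l_def m)
      have "(\<Sum>j=s..t. x j) < sqrt (real m * G)"
        using whole forward[where u = a and v = b] 1 by (simp add: m G_def)
      moreover have "real l * P3 = sqrt (real m * G) + 2 * lam" using \<open>l = m\<close> m1 by (simp add: P3_def)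
      ultimately show ?thesis using 1 pos unfolding lB by simp
    next
      case 2
      have "(\<Sum>j=s..t. x j) < lil_boundary \<delta> l"
        using from_left[of l] forward[where u = s and v = t] 2 l1 lm by (simp add: l_def)
      moreover have "d \<le> l" using st 2 by (auto simp: d l_def)
      ultimately show ?thesis using 2 pos lil_P1 unfolding lB by simp
    next
      case 3
      have "(\<Sum>j=s..t. x j) < lil_boundary \<delta> l"
        using from_right[of l] backward[where u = s and v = t] 3 l1 lm by (simp add: l_def)
      moreover have "d \<le> l" using st 3 by (auto simp: d l_def)
      ultimately show ?thesis using 3 pos lil_P1 unfolding lB by simp
    next
      case 4
      \<comment> \<open>\<open>2 * sqrt (u * v) \<le> u + v\<close> at \<open>u = lam\<close> and \<open>v = k * P2\<close>\<close>
      have am_gm: "lil_boundary \<delta> k \<le> lam + real k * P2" if "1 \<le> k" "k \<le> m" for k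
      proof -
        have "lil_boundary \<delta> k \<le> 2 * sqrt (real k * H)"
          unfolding lil_boundary_def H_def G_def using that loglog_mono[of "real k" "real m"]
          by (intro mult_left_mono real_sqrt_le_mono) auto
        also have "real k * H = lam * (real k * P2)" using lam by (simp add: P2_def)
        also have "2 * sqrt (lam * (real k * P2)) \<le> lam + real k * P2"
          using arith_geo_mean_sqrt[of lam "real k * P2"] lam P2 by simp
        finally show ?thesis by simp
      qed
      define l\<^sub>1 where "l\<^sub>1 = i + 1 - s"
      define l\<^sub>2 where "l\<^sub>2 = t - i"
      have "(\<Sum>j=s..t. x j) = (\<Sum>j=s..i. x j) + (\<Sum>j=i+1..t. x j)"
        using st sum.ub_add_nat[of s i x "t - i"] by simp
      also have "(\<Sum>j=s..i. x j) \<le> lam + real l\<^sub>1 * P2"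
      proof -
        have "(\<Sum>j=s..i. x j) < lil_boundary \<delta> l\<^sub>1"
        proof -
          have "l\<^sub>1 \<in> {1..i + 1 - a}" using st unfolding l\<^sub>1_def atLeastAtMost_iff by linarith
          from down[OF this] show ?thesis
            using backward[where u = s and v = i] by (simp add: l\<^sub>1_def)
        qed
        also have "\<dots> \<le> lam + real l\<^sub>1 * P2" by (rule am_gm) (use st in \<open>auto simp: l\<^sub>1_def m\<close>)
        finally show ?thesis by simp
      qed
      also have "(\<Sum>j=i+1..t. x j) \<le> lam + real l\<^sub>2 * P2"
      proof (cases "t = i")
        case True
        thus ?thesis using lam by (simp add: l\<^sub>2_def)
      next
        case False
        have "(\<Sum>j=i+1..t. x j) < lil_boundary \<delta> l\<^sub>2"
        proof -
          have "l\<^sub>2 \<in> {1..b - i}" using st False unfolding l\<^sub>2_def atLeastAtMost_iff by linarith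
          from up[OF this] show ?thesis
            using forward[where u = "i + 1" and v = t] by (simp add: l\<^sub>2_def)
        qed
        also have "\<dots> \<le> lam + real l\<^sub>2 * P2" by (rule am_gm) (use st False in \<open>auto simp: l\<^sub>2_def m\<close>)
        finally show ?thesis by simp
      qed
      finally have "(\<Sum>j=s..t. x j) \<le> 2 * lam + real (l\<^sub>1 + l\<^sub>2) * P2" by (simp add: algebra_simps)
      moreover have "l\<^sub>1 + l\<^sub>2 = l" using st by (simp add: l\<^sub>1_def l\<^sub>2_def l_def)
      ultimately show ?thesis using 4 pos unfolding lB by simp
    qed
  qed
  thus ?thesis by (simp add: B l_def)
qed

section \<open>The probability of overestimation\<close>

text \<open>
  The random level \<open>u\<close> at which the distribution is large can be replaced by one deterministic half-line: \<open>A\<close> is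
  the intersection of all open half-lines of mass at least \<open>v\<close>. For \<open>v > 0\<close>, if there is no smallest one,
  \<open>A\<close> is closed and right continuity gives it mass at least \<open>v\<close>. No uniformity over \<open>u\<close> is
  needed afterwards.
\<close>

lemma (in real_distribution) half_line_threshold:
  assumes ex: "\<exists>u. v \<le> prob {..<u}"
  obtains A where "A \<in> sets borel" "v \<le> prob A" "\<And>u. v \<le> prob {..<u} \<Longrightarrow> A \<subseteq> {..<u}"
proof -
  define U where "U = {u. v \<le> prob {..<u}}"
  have "U \<noteq> {}" using ex by (auto simp: U_def)
  consider "v \<le> 0" | u where "u \<in> U" "\<And>w. w \<in> U \<Longrightarrow> u \<le> w"
    | "v > 0" "\<And>u. u \<in> U \<Longrightarrow> \<exists>w\<in>U. w < u"
    by (meson not_le)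
  thus ?thesis
  proof cases
    case 1
    thus ?thesis using that[of "{}"] by simp
  next
    case (2 u)
    thus ?thesis using that[of "{..<u}"] by (auto simp: U_def intro: less_le_trans)
  next
    case 3
    have le_cdf: "v \<le> cdf M x" if "u \<in> U" "u \<le> x" for u x
    proof -
      have "prob {..<u} \<le> prob {..x}" using that(2) by (intro finite_measure_mono) auto
      thus ?thesis using that(1) by (simp add: U_def cdf_def2)
    qed
    have "eventually (\<lambda>x. cdf M x < v) at_bot"
      using cdf_lim_at_bot 3(1) by (rule order_tendstoD)
    then obtain x\<^sub>0 where "cdf M x\<^sub>0 < v" by (auto simp: eventually_at_bot_linorder)
    hence bdd: "bdd_below U" using le_cdf by (intro bdd_belowI[of _ x\<^sub>0]) (meson not_le linear)
    have "v \<le> cdf M (Inf U)"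
    proof (rule tendsto_lowerbound)
      show "(cdf M \<longlongrightarrow> cdf M (Inf U)) (at_right (Inf U))"
        using cdf_is_right_cont by (simp add: continuous_within)
      have "v \<le> cdf M x" if "Inf U < x" for x
        using cInf_lessD[OF \<open>U \<noteq> {}\<close> that] le_cdf by (auto intro: less_imp_le)
      thus "eventually (\<lambda>x. v \<le> cdf M x) (at_right (Inf U))"
        by (intro eventually_at_rightI[of _ "Inf U + 1"]) auto
    qed simp
    moreover have "{..Inf U} \<subseteq> {..<u}" if "v \<le> prob {..<u}" for u
    proof -
      obtain w where "w \<in> U" "w < u" using 3(2)[of u] \<open>v \<le> prob {..<u}\<close> by (auto simp: U_def)
      hence "Inf U < u" using cInf_lower[OF _ bdd] by (meson le_less_trans)
      thus ?thesis by auto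
    qed
    ultimately show ?thesis using that[of "{..Inf U}"] by (simp add: cdf_def2)
  qed
qed

text \<open>
  If the fit overestimates at \<open>i\<close> by \<open>u\<close> with \<open>P (\<epsilon> < u) \<ge> \<tau> + B\<close>, then the component of the
  superlevel set around \<open>i\<close> contains too few observations below the fit. Replacing \<open>\<epsilon> j < u\<close> by the
  smaller event \<open>\<epsilon> j \<in> A\<close> of mass \<open>q \<ge> \<tau> + B\<close> leaves an interval on which the sum of the centred variables
  \<open>q - indicator A (\<epsilon> j)\<close> is too large. Outside one event for the whole piece and four crossing
  events, for the walks from both ends of the piece and from \<open>i\<close> in both directions, this is impossible.
\<close>

lemma (in prob_space) overestimation_bound:
  fixes \<epsilon> :: "nat \<Rightarrow> 'a \<Rightarrow> real" and \<theta>_hat :: "'a \<Rightarrow> nat \<Rightarrow> real"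
  assumes lam: "lam > 0" and \<delta>: "0 < \<delta>" "\<delta> < ln 2 / exp 1"
    and indep: "indep_vars (\<lambda>_. borel) \<epsilon> {1..n}"
    and distr: "\<And>j. j \<in> {1..n} \<Longrightarrow> distr M borel (\<epsilon> j) = D"
    and opt: "\<And>\<omega>. \<omega> \<in> space M \<Longrightarrow>
        is_arg_min (fused_objective \<tau> lam n (\<lambda>j. \<theta> j + \<epsilon> j \<omega>)) (\<lambda>_. True) (\<theta>_hat \<omega>)"
    and ab: "1 \<le> a" "a \<le> i" "i \<le> b" "b \<le> n"
    and const: "\<And>j. j \<in> {a..b} \<Longrightarrow> \<theta> j = \<theta> i"
    and m: "m = b + 1 - a" and d: "d = min (i + 1 - a) (b + 1 - i)"
  shows "prob {\<omega> \<in> space M. fit_error_bound lam m d \<delta> \<le> measure D {..<\<theta>_hat \<omega> i - \<theta> i} - \<tau>}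
    \<le> (1 + 8 / (ln 2)\<^sup>2) * \<delta>\<^sup>2"
proof (cases "\<exists>u. \<tau> + fit_error_bound lam m d \<delta> \<le> measure D {..<u}")
  case False
  hence "{\<omega> \<in> space M. fit_error_bound lam m d \<delta> \<le> measure D {..<\<theta>_hat \<omega> i - \<theta> i} - \<tau>} = {}"
    by (auto simp: le_diff_eq add.commute)
  thus ?thesis by (simp only: measure_empty) simp
next
  case True
  define B where "B = fit_error_bound lam m d \<delta>"
  have rv: "\<epsilon> j \<in> borel_measurable M" if "j \<in> {1..n}" for j
    using indep that by (auto simp: indep_vars_def)
  have "real_distribution (distr M borel (\<epsilon> i))" using rv ab by (intro real_distribution_distr) auto
  then interpret D: real_distribution D using distr[of i] ab by auto
  obtain A where A: "A \<in> sets borel" "\<tau> + B \<le> measure D A"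
    "\<And>u. \<tau> + B \<le> measure D {..<u} \<Longrightarrow> A \<subseteq> {..<u}"
    using D.half_line_threshold[of "\<tau> + B"] True unfolding B_def by metis
  define q where "q = measure D A"
  define X where "X j \<omega> = q - indicator A (\<epsilon> j \<omega>)" for j \<omega>
  interpret centred_unit_range_noise M X "{1..n}" "q - 1"
  proof
    have "(\<lambda>x. q - indicator A x) \<in> borel_measurable borel" using A(1) by simp
    thus "indep_vars (\<lambda>_. borel) X {1..n}"
      unfolding X_def by (intro indep_vars_compose2[OF indep]) auto
    show "X j \<omega> \<in> {q - 1..q - 1 + 1}" for j \<omega> by (simp add: X_def indicator_def)
    fix j assume j: "j \<in> {1..n}"
    have [measurable]: "\<epsilon> j \<in> borel_measurable M" "A \<in> sets borel" using rv j A by auto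
    have "expectation (X j) = q - expectation (\<lambda>\<omega>. indicator A (\<epsilon> j \<omega>))"
      unfolding X_def by (subst Bochner_Integration.integral_diff)
        (auto simp: prob_space intro!: integrable_const_bound[where B = 1])
    also have "expectation (\<lambda>\<omega>. indicator A (\<epsilon> j \<omega>)) = (\<integral>x. indicat_real A x \<partial>distr M borel (\<epsilon> j))"
      by (rule integral_distr[symmetric]) auto
    also have "\<dots> = q" using distr[OF j] by (simp add: q_def)
    finally show "expectation (X j) = 0" by simp
  qed
  define G where "G = ln (1 / \<delta>)"
  have "ln 2 / exp 1 \<le> ln (2::real) / 1" by (intro divide_left_mono) auto
  hence "\<delta> < 1" using \<delta> ln_2_less_1 by linarith
  hence G: "G > 0" using \<delta> by (simp add: G_def)
  have m1: "1 \<le> m" using ab by (simp add: m)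
  \<comment> \<open>\<open>W\<close> costs \<open>\<delta>\<^sup>2\<close> and each of the four crossing events \<open>2 * (\<delta> / ln 2)\<^sup>2\<close>.\<close>
  define E where "E \<sigma> N = {\<omega> \<in> space M. \<exists>t\<in>{1..N}. lil_boundary \<delta> t \<le> walk \<sigma> t \<omega>}" for \<sigma> N
  define W where "W = {\<omega> \<in> space M. \<exists>t\<in>{..m}. sqrt (real m * G) \<le> walk (\<lambda>j. a + j) t \<omega>}"
  have W_meas: "W \<in> events"
    unfolding W_def by (rule measurable_maximal_event[where N = m]) (use ab in \<open>auto simp: m\<close>)
  have W_prob: "prob W \<le> \<delta>\<^sup>2"
  proof -
    have "prob W \<le> exp (- (2 * (sqrt (real m * G))\<^sup>2 / real m))"
      unfolding W_def Bex_def atMost_iff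
      by (rule maximal_hoeffding) (use ab m1 G in \<open>auto simp: m inj_on_def\<close>)
    also have "\<dots> = exp (- (2 * G))" using m1 G by simp
    also have "\<dots> = (exp (- G))\<^sup>2" by (simp flip: exp_double)
    also have "exp (- G) = \<delta>" using \<delta> by (simp add: G_def ln_div)
    finally show ?thesis .
  qed
  have E_meas: "E \<sigma> N \<in> events" if "\<sigma> ` {..<N} \<subseteq> {1..n}" for \<sigma> N
    unfolding E_def by (rule measurable_maximal_event[OF that]) auto
  have E_prob: "prob (E \<sigma> N) \<le> 2 * (\<delta> / ln 2)\<^sup>2" if "inj_on \<sigma> {..<N}" "\<sigma> ` {..<N} \<subseteq> {1..n}" for \<sigma> N
    unfolding E_def by (rule finite_lil[OF that \<delta>])
  define E\<^sub>1 where "E\<^sub>1 = E (\<lambda>j. a + j) m"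
  define E\<^sub>2 where "E\<^sub>2 = E (\<lambda>j. b - j) m"
  define E\<^sub>3 where "E\<^sub>3 = E (\<lambda>j. i - j) (i + 1 - a)"
  define E\<^sub>4 where "E\<^sub>4 = E (\<lambda>j. i + 1 + j) (b - i)"
  have E_events: "E\<^sub>1 \<in> events" "E\<^sub>2 \<in> events" "E\<^sub>3 \<in> events" "E\<^sub>4 \<in> events"
    unfolding E\<^sub>1_def E\<^sub>2_def E\<^sub>3_def E\<^sub>4_def by (rule E_meas, use ab in \<open>auto simp: m\<close>)+
  have E_probs: "prob E\<^sub>1 \<le> 2 * (\<delta> / ln 2)\<^sup>2" "prob E\<^sub>2 \<le> 2 * (\<delta> / ln 2)\<^sup>2"
    "prob E\<^sub>3 \<le> 2 * (\<delta> / ln 2)\<^sup>2" "prob E\<^sub>4 \<le> 2 * (\<delta> / ln 2)\<^sup>2"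
    unfolding E\<^sub>1_def E\<^sub>2_def E\<^sub>3_def E\<^sub>4_def
    by (rule E_prob; use ab in \<open>auto simp: m inj_on_def\<close>)+
  have "{\<omega> \<in> space M. B \<le> measure D {..<\<theta>_hat \<omega> i - \<theta> i} - \<tau>} \<subseteq> W \<union> (E\<^sub>1 \<union> (E\<^sub>2 \<union> (E\<^sub>3 \<union> E\<^sub>4)))"
  proof (rule subsetI, rule ccontr)
    fix \<omega> assume \<omega>: "\<omega> \<in> {\<omega> \<in> space M. B \<le> measure D {..<\<theta>_hat \<omega> i - \<theta> i} - \<tau>}"
      and good: "\<omega> \<notin> W \<union> (E\<^sub>1 \<union> (E\<^sub>2 \<union> (E\<^sub>3 \<union> E\<^sub>4)))"
    have \<omega>M: "\<omega> \<in> space M" and A_sub: "A \<subseteq> {..<\<theta>_hat \<omega> i - \<theta> i}"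
      using \<omega> A(3) by auto
    obtain s t where st: "a \<le> s" "s \<le> i" "i \<le> t" "t \<le> b" and
      count: "(\<Sum>j=s..t. of_bool (\<theta> j + \<epsilon> j \<omega> < \<theta>_hat \<omega> i)) \<le> \<tau> * (real t - real s + 1)
        + lam * ((if s = a then 1 else - 1) + (if t = b then 1 else - 1))"
      by (rule few_observations_below_fit[OF opt[OF \<omega>M] less_imp_le[OF lam] ab])
    have len: "real (t + 1 - s) = real t - real s + 1" using st by (simp add: of_nat_diff)
    have "(\<Sum>j=s..t. X j \<omega>) + lam * ((if s = a then 1 else - 1) + (if t = b then 1 else - 1))
        < real (t + 1 - s) * B"
      unfolding B_def
    proof (rule interval_sums_below_bound[OF lam \<delta> ab(2,3) m d])
      show "(\<Sum>j<m. X (a + j) \<omega>) < sqrt (real m * ln (1 / \<delta>))"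
        using good \<omega>M by (auto simp: W_def walk_def G_def not_le)
      show "(\<Sum>j<t. X (a + j) \<omega>) < lil_boundary \<delta> t" if "t \<in> {1..m}" for t
        using good \<omega>M that by (auto simp: E\<^sub>1_def E_def walk_def not_le)
      show "(\<Sum>j<t. X (b - j) \<omega>) < lil_boundary \<delta> t" if "t \<in> {1..m}" for t
        using good \<omega>M that by (auto simp: E\<^sub>2_def E_def walk_def not_le)
      show "(\<Sum>j<t. X (i - j) \<omega>) < lil_boundary \<delta> t" if "t \<in> {1..i + 1 - a}" for t
        using good \<omega>M that unfolding E\<^sub>3_def E_def walk_def by force
      show "(\<Sum>j<t. X (i + 1 + j) \<omega>) < lil_boundary \<delta> t" if "t \<in> {1..b - i}" for t
        using good \<omega>M that unfolding E\<^sub>4_def E_def walk_def by force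
    qed fact+
    moreover have "real (t + 1 - s) * B \<le> real (t + 1 - s) * (q - \<tau>)"
      using A(2) by (intro mult_left_mono) (auto simp: q_def)
    moreover have "(\<Sum>j=s..t. X j \<omega>) = real (t + 1 - s) * q - (\<Sum>j=s..t. indicator A (\<epsilon> j \<omega>))"
      by (simp add: X_def sum_subtractf)
    moreover have "(\<Sum>j=s..t. indicator A (\<epsilon> j \<omega>) :: real)
        \<le> (\<Sum>j=s..t. of_bool (\<theta> j + \<epsilon> j \<omega> < \<theta>_hat \<omega> i))"
    proof (rule sum_mono)
      fix j assume "j \<in> {s..t}"
      hence "\<theta> j = \<theta> i" using st by (intro const) auto
      thus "indicator A (\<epsilon> j \<omega>) \<le> (of_bool (\<theta> j + \<epsilon> j \<omega> < \<theta>_hat \<omega> i) :: real)"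
        using A_sub by (auto simp: indicator_def)
    qed
    ultimately show False using count unfolding len by (simp add: algebra_simps)
  qed
  hence "prob {\<omega> \<in> space M. B \<le> measure D {..<\<theta>_hat \<omega> i - \<theta> i} - \<tau>}
      \<le> prob (W \<union> (E\<^sub>1 \<union> (E\<^sub>2 \<union> (E\<^sub>3 \<union> E\<^sub>4))))"
    using W_meas E_events by (intro finite_measure_mono) auto
  also have "\<dots> \<le> prob W + (prob E\<^sub>1 + (prob E\<^sub>2 + (prob E\<^sub>3 + prob E\<^sub>4)))"
    using W_meas E_events by (intro order_trans[OF measure_Un_le] add_left_mono) auto
  also have "\<dots> \<le> \<delta>\<^sup>2 + 8 * (\<delta> / ln 2)\<^sup>2" using W_prob E_probs by linarith
  also have "\<dots> = (1 + 8 / (ln 2)\<^sup>2) * \<delta>\<^sup>2" by (simp add: power_divide algebra_simps)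
  finally show ?thesis by (simp add: B_def)
qed

section \<open>The piece around an index\<close>

lemma piece_of_index:
  assumes pc: "piecewise_constant n K p \<theta>" and i: "i \<in> {1..n}"
  defines "k \<equiv> piece_index K p i"
  shows "1 \<le> p k" "p k \<le> i" "i < p (k + 1)" "p (k + 1) \<le> n + 1"
    and "\<And>j. j \<in> {p k..p (k + 1) - 1} \<Longrightarrow> \<theta> j = \<theta> i"
proof -
  have K: "K \<ge> 1" "p 1 = 1" "p K < n" "p (K + 1) = n + 1"
    and const: "\<And>k j. k \<in> {1..K} \<Longrightarrow> j \<in> {p k..p (k + 1) - 1} \<Longrightarrow> \<theta> j = \<theta> (p k)"
    and "strict_mono_on {1..K} p"
    using pc unfolding piecewise_constant_def by blast+
  hence mono: "p k < p l" if "1 \<le> k" "k < l" "l \<le> K" for k l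
    using that by (auto elim: strict_mono_onD)
  define P where "P k \<longleftrightarrow> k \<in> {1..K} \<and> p k \<le> i \<and> i \<le> p (k + 1) - 1" for k
  define Q where "Q k \<longleftrightarrow> k \<in> {1..K} \<and> p k \<le> i" for k
  define k\<^sub>0 where "k\<^sub>0 = (GREATEST k. Q k)"
  have "Q 1" using K i by (simp add: Q_def)
  hence Q: "Q k\<^sub>0" unfolding k\<^sub>0_def by (rule GreatestI_nat[of Q 1 K]) (simp add: Q_def)
  have "i < p (k\<^sub>0 + 1)"
  proof (cases "k\<^sub>0 = K")
    case True
    thus ?thesis using K i by simp
  next
    case False
    show ?thesis
    proof (rule ccontr)
      assume "\<not> i < p (k\<^sub>0 + 1)"
      hence "Q (k\<^sub>0 + 1)" using False Q by (auto simp: Q_def)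
      hence "k\<^sub>0 + 1 \<le> k\<^sub>0" unfolding k\<^sub>0_def by (rule Greatest_le_nat[of Q _ K]) (simp add: Q_def)
      thus False by simp
    qed
  qed
  hence P: "P k\<^sub>0" using Q by (auto simp: P_def Q_def)
  have disjoint: False if "P k" "P l" "k < l" for k l
  proof -
    have "p (k + 1) \<le> p l" using that mono[of "k + 1" l] by (cases "k + 1 = l") (auto simp: P_def)
    moreover have "1 < p (k + 1)" using that i mono[of k "k + 1"] by (auto simp: P_def)
    ultimately show False using that by (auto simp: P_def)
  qed
  have unique: "l = k\<^sub>0" if "P l" for l
    using disjoint[OF that P] disjoint[OF P that] by (meson linorder_neqE_nat)
  have "piece_index K p i = k\<^sub>0"
    unfolding piece_index_def P_def[symmetric]
    using P unique by (rule the_equality)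
  hence k: "k = k\<^sub>0" by (simp add: k_def)
  show "1 \<le> p k" using mono[of 1 k] K Q k by (cases "k = 1") (auto simp: Q_def)
  show "p k \<le> i" "i < p (k + 1)" using Q \<open>i < p (k\<^sub>0 + 1)\<close> k by (auto simp: Q_def)
  show "p (k + 1) \<le> n + 1"
  proof (cases "k = K")
    case False
    hence "p (k + 1) \<le> p K" using mono[of "k + 1" K] Q k by (cases "k + 1 = K") (auto simp: Q_def)
    thus ?thesis using K by simp
  qed (use K in simp)
  fix j assume "j \<in> {p k..p (k + 1) - 1}"
  hence "\<theta> j = \<theta> (p k)" using const Q k by (auto simp: Q_def)
  moreover have "\<theta> i = \<theta> (p k)" using const[of k i] P k by (auto simp: P_def)
  ultimately show "\<theta> j = \<theta> i" by simp
qed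

lemma B_quantile_eq_fit_error_bound:
  "B_quantile lam K p i \<delta> = fit_error_bound lam (piece_length p (piece_index K p i)) (boundary_dist K p i) \<delta>"
  by (simp add: B_quantile_def fit_error_bound_def Let_def)

section \<open>Reflection and the two-sided statement\<close>

lemma quantile_loss_reflect: "quantile_loss (1 - \<tau>) (- x) = quantile_loss \<tau> x"
  by (simp add: quantile_loss_def)

text \<open>
  Negating data and fit exchanges the roles of \<open>\<tau>\<close> and \<open>1 - \<tau>\<close>; this turns underestimation into
  overestimation.
\<close>

lemma fused_objective_reflect:
  "fused_objective (1 - \<tau>) lam n (\<lambda>j. - y j) (\<lambda>j. - h j) = fused_objective \<tau> lam n y h"
proof -
  have "quantile_loss (1 - \<tau>) (- y j - - h j) = quantile_loss \<tau> (y j - h j)" for j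
    using quantile_loss_reflect[of \<tau> "y j - h j"] by simp
  moreover have "\<bar>- h j - - h (j + 1)\<bar> = \<bar>h j - h (j + 1)\<bar>" for j
    by simp
  ultimately show ?thesis unfolding fused_objective_def by presburger
qed

lemma is_arg_min_reflect:
  assumes "is_arg_min (fused_objective \<tau> lam n y) (\<lambda>_. True) h"
  shows "is_arg_min (fused_objective (1 - \<tau>) lam n (\<lambda>j. - y j)) (\<lambda>_. True) (\<lambda>j. - h j)"
proof -
  have "fused_objective (1 - \<tau>) lam n (\<lambda>j. - y j) g = fused_objective \<tau> lam n y (\<lambda>j. - g j)" for g
    using fused_objective_reflect[of \<tau> lam n y "\<lambda>j. - g j"] by simp
  thus ?thesis using assms by (simp add: is_arg_min_def)
qed

text \<open>
  The first claim is the overestimation bound on the piece around \<open>i\<close>, since continuity at zero makes the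
  left limit there equal to \<open>\<tau>\<close>. The second follows by reflection. The proof gives the constant
  \<open>8\<close> in place of \<open>24\<close>.
\<close>

theorem theorem12:
  fixes M :: "'a measure"
    and \<epsilon> :: "nat \<Rightarrow> 'a \<Rightarrow> real"
    and F :: "real \<Rightarrow> real"
    and \<tau> lam \<delta> :: real
    and n K i :: nat
    and p :: "nat \<Rightarrow> nat"
    and \<theta> :: "nat \<Rightarrow> real"
    and \<theta>_hat :: "'a \<Rightarrow> nat \<Rightarrow> real"
  assumes "prob_space M"
    and "0 < \<tau>" and "\<tau> < 1" and "lam > 0"
    and "piecewise_constant n K p \<theta>"
    and "prob_space.indep_vars M (\<lambda>_. borel) \<epsilon> {1..n}"
    and "\<And>j. j \<in> {1..n} \<Longrightarrow> cdf (distr M borel (\<epsilon> j)) = F"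
    and "F 0 = \<tau>"
    and "isCont F 0"
    and "\<And>s. s < 0 \<Longrightarrow> F s < F 0"
    and "\<And>t. t > 0 \<Longrightarrow> F 0 < F t"
    and "\<And>j. j \<in> {1..n} \<Longrightarrow> (\<lambda>\<omega>. \<theta>_hat \<omega> j) \<in> borel_measurable M"
    and "\<And>\<omega>. \<omega> \<in> space M \<Longrightarrow>
           is_arg_min (fused_objective \<tau> lam n (\<lambda>j. \<theta> j + \<epsilon> j \<omega>)) (\<lambda>_. True) (\<theta>_hat \<omega>)"
    and "i \<in> {1..n}"
    and "0 < \<delta>" and "\<delta> < ln 2 / exp 1"
  shows "measure M {\<omega> \<in> space M.
            left_limit F (\<theta>_hat \<omega> i - \<theta> i) - left_limit F 0 \<ge> B_quantile lam K p i \<delta>}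
           \<le> (1 + 24 / (ln 2)\<^sup>2) * \<delta>\<^sup>2
       \<and> measure M {\<omega> \<in> space M.
            F 0 - F (\<theta>_hat \<omega> i - \<theta> i) \<ge> B_quantile lam K p i \<delta>}
           \<le> (1 + 24 / (ln 2)\<^sup>2) * \<delta>\<^sup>2"
proof -
  interpret prob_space M by fact
  note lam = assms(4) and indep = assms(6) and opt = assms(13) and i = assms(14) and \<delta> = assms(15,16)
  define k where "k = piece_index K p i"
  define a where "a = p k"
  define b where "b = p (k + 1) - 1"
  define m where "m = piece_length p k"
  define d where "d = boundary_dist K p i"
  note piece = piece_of_index[OF assms(5) i, folded k_def]
  have ab: "1 \<le> a" "a \<le> i" "i \<le> b" "b \<le> n" using piece(1-4) by (auto simp: a_def b_def)
  have const: "\<theta> j = \<theta> i" if "j \<in> {a..b}" for j using piece(5) that by (auto simp: a_def b_def)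
  have m: "m = b + 1 - a" using piece(3) by (simp add: m_def piece_length_def a_def b_def)
  have d: "d = min (i + 1 - a) (b + 1 - i)"
    using piece(3) by (simp add: d_def boundary_dist_def Let_def a_def b_def k_def)
  have B: "B_quantile lam K p i \<delta> = fit_error_bound lam m d \<delta>"
    by (simp add: B_quantile_eq_fit_error_bound m_def d_def k_def)
  have rv: "\<epsilon> j \<in> borel_measurable M" if "j \<in> {1..n}" for j
    using indep that by (auto simp: indep_vars_def)
  have real_distr: "real_distribution (distr M borel (\<epsilon> j))" if "j \<in> {1..n}" for j
    using rv[OF that] by (rule real_distribution_distr)
  define D where "D = distr M borel (\<epsilon> i)"
  have D_distr: "distr M borel (\<epsilon> j) = D" if "j \<in> {1..n}" for j
    unfolding D_def using assms(7) that i by (intro cdf_unique real_distr) auto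
  interpret D: real_distribution D unfolding D_def by (rule real_distr[OF i])
  have F: "F = cdf D" using assms(7)[OF i] by (simp add: D_def)
  have left_F: "left_limit F u = measure D {..<u}" for u
    unfolding left_limit_def F by (rule tendsto_Lim[OF _ D.cdf_at_left]) simp
  have "(F \<longlongrightarrow> F 0) (at_left 0)"
    using assms(9) unfolding isCont_def by (rule filterlim_mono) (auto simp: at_within_le_at)
  hence left_F_0: "left_limit F 0 = \<tau>"
    unfolding left_limit_def assms(8)[symmetric] by (intro tendsto_Lim) auto
  have slack: "(1 + 8 / (ln 2)\<^sup>2) * \<delta>\<^sup>2 \<le> (1 + 24 / (ln 2)\<^sup>2) * \<delta>\<^sup>2"
    by (intro mult_right_mono add_left_mono divide_right_mono) auto
  have "prob {\<omega> \<in> space M. fit_error_bound lam m d \<delta> \<le> measure D {..<\<theta>_hat \<omega> i - \<theta> i} - \<tau>}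
      \<le> (1 + 8 / (ln 2)\<^sup>2) * \<delta>\<^sup>2"
    by (rule overestimation_bound[OF lam \<delta> indep D_distr opt ab const m d])
  hence over: "prob {\<omega> \<in> space M.
      left_limit F (\<theta>_hat \<omega> i - \<theta> i) - left_limit F 0 \<ge> B_quantile lam K p i \<delta>}
      \<le> (1 + 24 / (ln 2)\<^sup>2) * \<delta>\<^sup>2"
    unfolding left_F_0 unfolding left_F B using slack by linarith
  \<comment> \<open>The second bound is the first one for \<open>- \<epsilon>\<close>, \<open>- \<theta>\<close> and \<open>1 - \<tau>\<close>: the mass that
    the reflected law gives to \<open>{..<- u}\<close> is \<open>1 - F u\<close>.\<close>
  define D' where "D' = distr M borel (\<lambda>\<omega>. - \<epsilon> i \<omega>)"
  have "distr M borel (\<lambda>\<omega>. - \<epsilon> j \<omega>) = distr D borel uminus" if "j \<in> {1..n}" for j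
    using rv[OF that] by (subst D_distr[OF that, symmetric], subst distr_distr) (auto simp: comp_def)
  hence D'_distr: "distr M borel (\<lambda>\<omega>. - \<epsilon> j \<omega>) = D'" if "j \<in> {1..n}" for j
    using that i by (simp add: D'_def)
  have D'_eq: "D' = distr D borel uminus"
    using rv[OF i] unfolding D'_def D_def by (subst distr_distr) (auto simp: comp_def)
  have reflect: "measure D' {..<- u} = 1 - F u" for u
  proof -
    have "uminus -` {..<- u} = UNIV - {..u}" by auto
    hence "measure D' {..<- u} = measure D (UNIV - {..u})"
      unfolding D'_eq by (subst measure_distr) auto
    also have "\<dots> = 1 - measure D {..u}" using D.prob_compl[of "{..u}"] by simp
    finally show ?thesis by (simp add: F cdf_def2)
  qed
  have indep': "indep_vars (\<lambda>_. borel) (\<lambda>j \<omega>. - \<epsilon> j \<omega>) {1..n}"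
    by (rule indep_vars_compose2[OF indep]) simp
  have opt': "is_arg_min (fused_objective (1 - \<tau>) lam n (\<lambda>j. - \<theta> j + - \<epsilon> j \<omega>)) (\<lambda>_. True)
      (\<lambda>j. - \<theta>_hat \<omega> j)" if "\<omega> \<in> space M" for \<omega>
    using is_arg_min_reflect[OF opt[OF that]] by (simp add: algebra_simps)
  have const': "- \<theta> j = - \<theta> i" if "j \<in> {a..b}" for j using const[OF that] by simp
  have "prob {\<omega> \<in> space M. fit_error_bound lam m d \<delta> \<le> measure D' {..<- \<theta>_hat \<omega> i - - \<theta> i} - (1 - \<tau>)}
      \<le> (1 + 8 / (ln 2)\<^sup>2) * \<delta>\<^sup>2"
    by (rule overestimation_bound[OF lam \<delta> indep' D'_distr opt' ab const' m d])
  also have "{\<omega> \<in> space M. fit_error_bound lam m d \<delta> \<le> measure D' {..<- \<theta>_hat \<omega> i - - \<theta> i} - (1 - \<tau>)}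
      = {\<omega> \<in> space M. F 0 - F (\<theta>_hat \<omega> i - \<theta> i) \<ge> B_quantile lam K p i \<delta>}"
    using reflect[of "\<theta>_hat _ i - \<theta> i"] by (simp add: B assms(8))
  finally show ?thesis using over slack by linarith
qed

end
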